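(* Let $R$ be an integral domain of characteristic zero and let $\mathcal A$ be a (commutative) integral domain containing $R$, regarded as an $R$-algebra. Then: (1) for every $R$-derivation or $R$-$\mathcal E$-derivation $\delta$ of $\mathcal A$ that is algebraic over $R$, the image $\operatorname{Im}\delta:=\delta(\mathcal A)$ is a Mathieu subspace of $\mathcal A$; (2) for every locally nilpotent $R$-derivation or locally nilpotent $R$-$\mathcal E$-derivation $\delta$ of $\mathcal A$ that is algebraic over $R$, and every ideal $I$ of $\mathcal A$, the image $\delta(I)$ is a Mathieu subspace of $\mathcal A$.
   Context: An $R$-derivation of $\mathcal A$ is an $R$-linear map $D:\mathcal A\to\mathcal A$ with $D(ab)=D(a)b+aD(b)$ for all $a,b\in\mathcal A$. An $R$-$\mathcal E$-derivation of $\mathcal A$ is an $R$-linear map $\delta$ with $\delta(ab)=\delta(a)b+a\delta(b)-\delta(a)\delta(b)$; equivalently $\delta=\mathrm I-\phi$, where $\mathrm I$ is the identity map of $\mathcal A$ and $\phi$ is an $R$-algebra endomorphism of $\mathcal A$ (an $R$-linear multiplicative map, not required to send $1$ to $1$). $\delta$ is algebraic over $R$ if there is a nonzero polynomial $f(t)\in R[t]$ with $f(\delta)=0$. $\delta$ is locally nilpotent if for each $a\in\mathcal A$ there is $m\ge 1$ with $\delta^m(a)=0$. An $R$-submodule $V$ of a commutative $R$-algebra $\mathcal A$ is a Mathieu subspace of $\mathcal A$ if for all $a,b,c\in\mathcal A$ with $a^m\in V$ for all $m\ge1$, one has $ba^mc\in V$ for all sufficiently large $m$. *)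

theory Defs
  imports Complex_Main "HOL-Computational_Algebra.Polynomial"
begin

(* A ring extension R <= A of integral domains with char R = 0 is rendered by two types
   and an injective unital ring homomorphism emb : R -> A. *)
locale domain_extension =
  fixes emb :: "'r::{idom,ring_char_0} \<Rightarrow> 'a::idom"
  assumes emb_one: "emb 1 = 1"
    and emb_add: "emb (x + y) = emb x + emb y"
    and emb_mult: "emb (x * y) = emb x * emb y"
    and inj_emb: "inj emb"

definition scal :: "('r::comm_ring_1 \<Rightarrow> 'a::comm_ring_1) \<Rightarrow> 'r \<Rightarrow> 'a \<Rightarrow> 'a"
  where "scal emb r a = emb r * a"

lemma (in domain_extension) module_scal: "module (scal emb)"
  by unfold_locales (simp_all add: scal_def emb_one emb_add emb_mult algebra_simps)

lemma module_self: "module ((*) :: 'a::comm_ring_1 \<Rightarrow> 'a \<Rightarrow> 'a)"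
  by unfold_locales (simp_all add: algebra_simps)

definition is_ideal :: "'a::comm_ring_1 set \<Rightarrow> bool"
  where "is_ideal I \<longleftrightarrow> module.subspace (*) I"

lemma is_ideal_iff:
  "is_ideal I \<longleftrightarrow> 0 \<in> I \<and> (\<forall>x\<in>I. \<forall>y\<in>I. x + y \<in> I) \<and> (\<forall>c. \<forall>x\<in>I. c * x \<in> I)"
  unfolding is_ideal_def module.subspace_def[OF module_self] ..

definition derivation :: "('r::comm_ring_1 \<Rightarrow> 'a::comm_ring_1) \<Rightarrow> ('a \<Rightarrow> 'a) \<Rightarrow> bool"
  where "derivation emb D \<longleftrightarrow>
    module_hom (scal emb) (scal emb) D \<and> (\<forall>a b. D (a * b) = D a * b + a * D b)"

definition E_derivation :: "('r::comm_ring_1 \<Rightarrow> 'a::comm_ring_1) \<Rightarrow> ('a \<Rightarrow> 'a) \<Rightarrow> bool"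
  where "E_derivation emb \<delta> \<longleftrightarrow>
    module_hom (scal emb) (scal emb) \<delta> \<and>
    (\<forall>a b. \<delta> (a * b) = \<delta> a * b + a * \<delta> b - \<delta> a * \<delta> b)"

lemma (in domain_extension) E_derivation_iff:
  "E_derivation emb \<delta> \<longleftrightarrow>
    (\<exists>\<phi>. module_hom (scal emb) (scal emb) \<phi> \<and> (\<forall>a b. \<phi> (a * b) = \<phi> a * \<phi> b) \<and>
      \<delta> = (\<lambda>a. a - \<phi> a))"
proof
  assume E: "E_derivation emb \<delta>"
  then interpret module_hom "scal emb" "scal emb" \<delta>
    by (simp add: E_derivation_def)
  have "module_hom (scal emb) (scal emb) (\<lambda>a. a - \<delta> a)"
    using module_scal add scale
    by (auto simp: module_hom_def module_hom_axioms_def m1.scale_right_diff_distrib)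
  then show "\<exists>\<phi>. module_hom (scal emb) (scal emb) \<phi> \<and> (\<forall>a b. \<phi> (a * b) = \<phi> a * \<phi> b) \<and>
      \<delta> = (\<lambda>a. a - \<phi> a)"
    using E by (intro exI[of _ "\<lambda>a. a - \<delta> a"]) (auto simp: E_derivation_def algebra_simps)
next
  assume "\<exists>\<phi>. module_hom (scal emb) (scal emb) \<phi> \<and> (\<forall>a b. \<phi> (a * b) = \<phi> a * \<phi> b) \<and>
      \<delta> = (\<lambda>a. a - \<phi> a)"
  then obtain \<phi> where \<phi>: "module_hom (scal emb) (scal emb) \<phi>"
      "\<And>a b. \<phi> (a * b) = \<phi> a * \<phi> b" "\<delta> = (\<lambda>a. a - \<phi> a)"
    by blast
  interpret module_hom "scal emb" "scal emb" \<phi> by (fact \<phi>(1))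
  have "module_hom (scal emb) (scal emb) \<delta>"
    using module_scal add scale
    by (auto simp: \<phi>(3) module_hom_def module_hom_axioms_def m1.scale_right_diff_distrib)
  then show "E_derivation emb \<delta>"
    by (simp add: E_derivation_def \<phi>(2,3) algebra_simps)
qed

(* f(delta), where delta^i is the i-fold composite *)
definition poly_op :: "('r::comm_ring_1 \<Rightarrow> 'a::comm_ring_1) \<Rightarrow> 'r poly \<Rightarrow> ('a \<Rightarrow> 'a) \<Rightarrow> 'a \<Rightarrow> 'a"
  where "poly_op emb f \<delta> a = (\<Sum>i\<le>degree f. scal emb (coeff f i) ((\<delta> ^^ i) a))"

definition algebraic_op :: "('r::comm_ring_1 \<Rightarrow> 'a::comm_ring_1) \<Rightarrow> ('a \<Rightarrow> 'a) \<Rightarrow> bool"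
  where "algebraic_op emb \<delta> \<longleftrightarrow> (\<exists>f. f \<noteq> 0 \<and> (\<forall>a. poly_op emb f \<delta> a = 0))"

definition locally_nilpotent :: "('a::zero \<Rightarrow> 'a) \<Rightarrow> bool"
  where "locally_nilpotent \<delta> \<longleftrightarrow> (\<forall>a. \<exists>m\<ge>1. (\<delta> ^^ m) a = 0)"

definition mathieu_subspace :: "('r::comm_ring_1 \<Rightarrow> 'a::comm_ring_1) \<Rightarrow> 'a set \<Rightarrow> bool"
  where "mathieu_subspace emb V \<longleftrightarrow>
    module.subspace (scal emb) V \<and>
    (\<forall>a b c. (\<forall>m\<ge>1. a ^ m \<in> V) \<longrightarrow> (\<forall>\<^sub>F m in sequentially. b * a ^ m * c \<in> V))"

end

theory Submission
  imports Defs
begin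

text \<open>Both kinds of operators are governed by independence over the domain \<open>A\<close>. If a derivation
  \<open>D\<close> has \<open>D a \<noteq> 0\<close>, then commuting with multiplication by \<open>a\<close> lowers the order of a differential
  operator and multiplies its leading coefficient by \<open>n * D a\<close>; so the powers of \<open>D\<close> are independent,
  and an algebraic derivation vanishes. For \<open>\<delta> = I - \<phi>\<close> the powers of \<open>\<phi>\<close> are characters of the
  multiplicative monoid of \<open>A\<close>, so algebraicity and Dedekind's theorem force \<open>\<phi>\<^sup>i = \<phi>\<^sup>i\<^sup>+\<^sup>k\<close> with \<open>k > 0\<close>.
  The trace \<open>\<phi>\<^sup>i + \<dots> + \<phi>\<^sup>i\<^sup>+\<^sup>k\<^sup>-\<^sup>1\<close> kills the image of \<open>\<delta>\<close>. If all powers of \<open>a\<close> lie in this image, then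
  all power sums of the \<open>\<phi>\<^sup>i\<^sup>+\<^sup>l a\<close> vanish, so \<open>\<phi>\<^sup>i a = 0\<close>, while the kernel of \<open>\<phi>\<^sup>i\<close> is an ideal contained
  in the image of \<open>\<delta>\<close>. If \<open>\<delta>\<close> is moreover locally nilpotent, then \<open>\<phi>\<close> is unipotent of finite order,
  hence the identity.\<close>

section \<open>Independence of characters and vanishing power sums\<close>

text \<open>Artin's argument by induction on the number of characters. The operation
  \<open>op\<close> is left abstract so that the result covers both multiplication in the ring and
  addition of exponents.\<close>

lemma dedekind_independence:
  fixes \<chi> :: "'i \<Rightarrow> 'b \<Rightarrow> 'a::idom" and op :: "'b \<Rightarrow> 'b \<Rightarrow> 'b"
  assumes "finite I" "inj_on \<chi> I"
    and mult: "\<And>i x y. i \<in> I \<Longrightarrow> \<chi> i (op x y) = \<chi> i x * \<chi> i y"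
    and nz: "\<And>i. i \<in> I \<Longrightarrow> \<exists>x. \<chi> i x \<noteq> 0"
    and zero: "\<And>x. (\<Sum>i\<in>I. c i * \<chi> i x) = 0"
    and "i \<in> I"
  shows "c i = 0"
  using assms
proof (induction I arbitrary: c i rule: finite_induct)
  case empty
  then show ?case by simp
next
  case (insert j I)
  have vanish: "c i = 0" if i: "i \<in> I" for i
  proof -
    have "\<chi> i \<noteq> \<chi> j"
      using insert.prems(1) insert.hyps(2) i by (auto simp: inj_on_def)
    then obtain y where y: "\<chi> i y \<noteq> \<chi> j y" by blast
    \<comment> \<open>Subtracting \<open>\<chi> j y\<close> times the relation at \<open>x\<close>
      from the relation at \<open>op y x\<close> cancels the character
      \<open>\<chi> j\<close>.\<close>
    have "(\<Sum>l\<in>I. (c l * (\<chi> l y - \<chi> j y)) * \<chi> l x) = 0" for x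
    proof -
      have "(\<Sum>l\<in>I. (c l * (\<chi> l y - \<chi> j y)) * \<chi> l x)
          = (\<Sum>l\<in>insert j I. (c l * (\<chi> l y - \<chi> j y)) * \<chi> l x)"
        using insert.hyps by simp
      also have "\<dots> = (\<Sum>l\<in>insert j I. c l * \<chi> l (op y x)) - \<chi> j y * (\<Sum>l\<in>insert j I. c l * \<chi> l x)"
        unfolding sum_distrib_left sum_subtractf[symmetric]
        by (intro sum.cong refl) (simp add: insert.prems(2) algebra_simps)
      also have "\<dots> = 0"
        by (simp only: insert.prems(4)) simp
      finally show ?thesis .
    qed
    then have "c i * (\<chi> i y - \<chi> j y) = 0"
      by (intro insert.IH[of "\<lambda>l. c l * (\<chi> l y - \<chi> j y)"])
        (use insert.prems i in \<open>auto simp: inj_on_insert\<close>)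
    with y show ?thesis by simp
  qed
  obtain x where x: "\<chi> j x \<noteq> 0" using insert.prems(3) by blast
  have "c j * \<chi> j x = 0"
    using insert.prems(4)[of x] insert.hyps vanish by simp
  with x have "c j = 0" by simp
  with vanish insert.prems(5) show ?case by auto
qed

text \<open>Dedekind's theorem applied to the characters \<open>m \<mapsto> a\<^sup>m\<close> of the semigroup of positive integers.\<close>
lemma power_sums_zero_imp_zero:
  fixes x :: "'i \<Rightarrow> 'a::idom"
  assumes char0: "CHAR('a) = 0"
    and fin: "finite I"
    and zero: "\<And>m. m \<ge> 1 \<Longrightarrow> (\<Sum>i\<in>I. x i ^ m) = 0"
    and i: "i \<in> I"
  shows "x i = 0"
proof (rule ccontr)
  assume nz: "x i \<noteq> 0"
  \<comment> \<open>Equal values give equal characters, so the sum is grouped by distinct nonzero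
    values; \<open>c\<close> is the multiplicity of a value, nonzero in characteristic zero when the
    value occurs.\<close>
  define c where "c = (\<lambda>a. of_nat (card {l \<in> I. x l = a}) :: 'a)"
  have "(\<Sum>a\<in>x ` I - {0}. c a * a ^ Suc m) = 0" for m
  proof -
    have "(\<Sum>a\<in>x ` I - {0}. c a * a ^ Suc m) = (\<Sum>a\<in>x ` I. c a * a ^ Suc m)"
      using fin by (intro sum.mono_neutral_left) auto
    also have "\<dots> = (\<Sum>a\<in>x ` I. \<Sum>l\<in>{l \<in> I. x l = a}. x l ^ Suc m)"
      by (intro sum.cong refl) (simp add: c_def)
    also have "\<dots> = (\<Sum>l\<in>I. x l ^ Suc m)"
      using fin by (rule sum.image_gen[symmetric])
    finally show ?thesis using zero[of "Suc m"] by simp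
  qed
  moreover have "inj_on (\<lambda>a m. a ^ Suc m) (x ` I - {0})"
    by (rule inj_onI) (metis power_one_right One_nat_def)
  moreover have "\<exists>m. a ^ Suc m \<noteq> 0" if "a \<in> x ` I - {0}" for a
    using that by simp
  ultimately have "c (x i) = 0"
    using fin i nz
    \<comment> \<open>The index \<open>m\<close> stands for the exponent \<open>m + 1\<close>, so
      adding exponents becomes \<open>Suc (m + n)\<close>.\<close>
    by (intro dedekind_independence[of "x ` I - {0}" "\<lambda>a m. a ^ Suc m" "\<lambda>m n. Suc (m + n)" c])
      (auto simp: power_add)
  moreover have "card {l \<in> I. x l = x i} > 0"
    using fin i by (auto simp: card_gt_0_iff)
  ultimately show False
    using char0 by (simp add: c_def of_nat_eq_0_iff_char_dvd)
qed

lemma funpow_mult_hom: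
  fixes \<phi> :: "'a::times \<Rightarrow> 'a"
  assumes "\<And>x y. \<phi> (x * y) = \<phi> x * \<phi> y"
  shows "(\<phi> ^^ n) (x * y) = (\<phi> ^^ n) x * (\<phi> ^^ n) y"
  by (induction n) (simp_all add: assms)

section \<open>Preperiodicity of algebraic endomorphisms\<close>

lemma algebraic_endomorphism_preperiodic:
  fixes \<phi> :: "'a::idom \<Rightarrow> 'a"
  assumes mult: "\<And>x y. \<phi> (x * y) = \<phi> x * \<phi> y"
    and zero: "\<And>x. (\<Sum>i\<le>n. c i * (\<phi> ^^ i) x) = 0"
    and c: "c n \<noteq> 0"
  obtains i k where "k > 0" "\<phi> ^^ (i + k) = \<phi> ^^ i"
proof (cases "\<exists>i. \<forall>x. (\<phi> ^^ i) x = 0")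
  case True
  then obtain i where i: "\<And>x. (\<phi> ^^ i) x = 0" by blast
  \<comment> \<open>Dedekind's theorem needs nonzero characters; once some power vanishes
    identically, so does the next, and the period is 1.\<close>
  then have "\<phi> ^^ (i + 1) = \<phi> ^^ i"
    by (intro ext) (simp add: funpow_Suc_right del: funpow.simps)
  then show thesis by (intro that[of 1]) auto
next
  case False
  have "\<not> inj_on (\<lambda>i. \<phi> ^^ i) {..n}"
    using dedekind_independence[of "{..n}" "\<lambda>i. \<phi> ^^ i" "(*)" c n] False zero c
      funpow_mult_hom[of \<phi>, OF mult] by auto
  then obtain i j where "i < j" "\<phi> ^^ j = \<phi> ^^ i"
    unfolding inj_on_def by (metis linorder_neqE_nat)
  then show thesis
    by (intro that[of "j - i" i]) auto
qed

lemma funpow_diff_expansion: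
  fixes \<phi> :: "'a::comm_ring_1 \<Rightarrow> 'a"
  assumes "additive \<phi>"
  shows "((\<lambda>x. x - \<phi> x) ^^ n) x = (\<Sum>k\<le>n. (- 1) ^ k * of_nat (n choose k) * (\<phi> ^^ k) x)"
proof (induction n arbitrary: x)
  case 0
  then show ?case by simp
next
  case (Suc n)
  interpret additive \<phi> by fact
  have diffs: "(\<phi> ^^ k) (x - y) = (\<phi> ^^ k) x - (\<phi> ^^ k) y" for k x y
    by (induction k) (simp_all add: diff)
  have "((\<lambda>x. x - \<phi> x) ^^ Suc n) x = ((\<lambda>x. x - \<phi> x) ^^ n) (x - \<phi> x)"
    by (simp add: funpow_Suc_right del: funpow.simps)
  also have "\<dots> = (\<Sum>k\<le>n. (- 1) ^ k * of_nat (n choose k) * (\<phi> ^^ k) x)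
      + (\<Sum>k\<le>n. (- 1) ^ Suc k * of_nat (n choose k) * (\<phi> ^^ Suc k) x)"
    unfolding Suc.IH diffs sum.distrib[symmetric]
    by (intro sum.cong refl) (simp add: funpow_swap1 algebra_simps)
  also have "(\<Sum>k\<le>n. (- 1) ^ k * of_nat (n choose k) * (\<phi> ^^ k) x)
      = (\<Sum>k\<le>Suc n. (- 1) ^ k * of_nat (n choose k) * (\<phi> ^^ k) x)"
    by (simp add: binomial_eq_0)
  also have "\<dots> = x + (\<Sum>k\<le>n. (- 1) ^ Suc k * of_nat (n choose Suc k) * (\<phi> ^^ Suc k) x)"
    by (subst sum.atMost_Suc_shift) simp
  also have "\<dots> + (\<Sum>k\<le>n. (- 1) ^ Suc k * of_nat (n choose k) * (\<phi> ^^ Suc k) x)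
      = x + (\<Sum>k\<le>n. (- 1) ^ Suc k * of_nat (Suc n choose Suc k) * (\<phi> ^^ Suc k) x)"
    unfolding add.assoc sum.distrib[symmetric]
    by (intro arg_cong2[of _ _ _ _ "(+)"] sum.cong refl) (simp add: algebra_simps)
  also have "\<dots> = (\<Sum>k\<le>Suc n. (- 1) ^ k * of_nat (Suc n choose k) * (\<phi> ^^ k) x)"
    by (subst sum.atMost_Suc_shift) simp
  finally show ?case .
qed

lemma sum_triangle_swap:
  fixes f :: "nat \<Rightarrow> nat \<Rightarrow> 'a::comm_monoid_add"
  shows "(\<Sum>i\<le>n. \<Sum>k\<le>i. f i k) = (\<Sum>k\<le>n. \<Sum>i=k..n. f i k)"
  unfolding sum.Sigma[OF finite_atMost ballI[OF finite_atMost]]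
    sum.Sigma[OF finite_atMost ballI[OF finite_atLeastAtMost]]
  by (rule sum.reindex_bij_witness[of _ "\<lambda>(k, i). (i, k)" "\<lambda>(i, k). (k, i)"]) auto

lemma preperiodic_of_algebraic_diff:
  fixes \<phi> :: "'a::idom \<Rightarrow> 'a"
  assumes add: "additive \<phi>" and mult: "\<And>x y. \<phi> (x * y) = \<phi> x * \<phi> y"
    and zero: "\<And>x. (\<Sum>i\<le>n. c i * ((\<lambda>x. x - \<phi> x) ^^ i) x) = 0"
    and c: "c n \<noteq> 0"
  obtains i k where "k > 0" "\<phi> ^^ (i + k) = \<phi> ^^ i"
proof (rule algebraic_endomorphism_preperiodic[of \<phi>, OF mult])
  let ?d = "\<lambda>k. \<Sum>i=k..n. c i * ((- 1) ^ k * of_nat (i choose k))"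
  show "(\<Sum>k\<le>n. ?d k * (\<phi> ^^ k) x) = 0" for x
    using zero[of x]
    by (simp add: funpow_diff_expansion[OF add] sum_distrib_left sum_distrib_right
        sum_triangle_swap mult.assoc)
  \<comment> \<open>Only \<open>i = n\<close> contributes to the coefficient of
    \<open>\<phi> ^^ n\<close>, so it is \<open>c n\<close> up to sign.\<close>
  show "?d n \<noteq> 0" using c by simp
qed

section \<open>Powers of a derivation\<close>

lemma leibniz_funpow:
  fixes D :: "'a::comm_ring_1 \<Rightarrow> 'a"
  assumes "additive D" and leibniz: "\<And>a b. D (a * b) = D a * b + a * D b"
  shows "(D ^^ n) (a * b) = (\<Sum>k\<le>n. of_nat (n choose k) * (D ^^ (n - k)) a * (D ^^ k) b)"
proof (induction n arbitrary: a b)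
  case 0
  then show ?case by simp
next
  case (Suc n)
  interpret additive D by fact
  have adds: "(D ^^ k) (x + y) = (D ^^ k) x + (D ^^ k) y" for k x y
    by (induction k) (simp_all add: add)
  have "(D ^^ Suc n) (a * b) = (D ^^ n) (D a * b) + (D ^^ n) (a * D b)"
    by (simp add: funpow_swap1 leibniz adds)
  also have "(D ^^ n) (D a * b)
      = (\<Sum>k\<le>Suc n. of_nat (n choose k) * (D ^^ (Suc n - k)) a * (D ^^ k) b)"
    unfolding Suc.IH
    by (simp add: binomial_eq_0) (auto intro!: sum.cong simp: Suc_diff_le funpow_swap1)
  also have "\<dots> = (D ^^ Suc n) a * b
      + (\<Sum>k\<le>n. of_nat (n choose Suc k) * (D ^^ (n - k)) a * (D ^^ Suc k) b)"
    by (subst sum.atMost_Suc_shift) simp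
  also have "(D ^^ n) (a * D b) = (\<Sum>k\<le>n. of_nat (n choose k) * (D ^^ (n - k)) a * (D ^^ Suc k) b)"
    unfolding Suc.IH by (simp add: funpow_swap1)
  also have "(D ^^ Suc n) a * b
      + (\<Sum>k\<le>n. of_nat (n choose Suc k) * (D ^^ (n - k)) a * (D ^^ Suc k) b) + \<dots>
      = (D ^^ Suc n) a * b
      + (\<Sum>k\<le>n. of_nat (Suc n choose Suc k) * (D ^^ (n - k)) a * (D ^^ Suc k) b)"
    unfolding add.assoc sum.distrib[symmetric]
    by (intro arg_cong2[of _ _ _ _ "(+)"] sum.cong refl) (simp add: algebra_simps)
  also have "\<dots> = (\<Sum>k\<le>Suc n. of_nat (Suc n choose k) * (D ^^ (Suc n - k)) a * (D ^^ k) b)"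
    by (subst sum.atMost_Suc_shift) simp
  finally show ?case .
qed

lemma derivation_powers_independent:
  fixes D :: "'a::idom \<Rightarrow> 'a"
  assumes char0: "CHAR('a) = 0"
    and add: "additive D" and leibniz: "\<And>a b. D (a * b) = D a * b + a * D b"
    and "D a \<noteq> 0"
    and "\<And>b. (\<Sum>i\<le>n. c i * (D ^^ i) b) = 0"
  shows "c n = 0"
  using assms(5)
proof (induction n arbitrary: c)
  case 0
  from 0[of 1] show ?case by simp
next
  case (Suc n)
  \<comment> \<open>By Leibniz, \<open>?t i k\<close> is the coefficient of
    \<open>(D ^^ k) b\<close> in \<open>(D ^^ i) (a * b)\<close>. The terms with
    \<open>i = k\<close> add up to \<open>a\<close> times the given relation; \<open>?e\<close>
    collects the rest, the commutator with multiplication by \<open>a\<close>, of order at most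
    \<open>n\<close>.\<close>
  let ?t = "\<lambda>i k. of_nat (i choose k) * (D ^^ (i - k)) a"
  let ?e = "\<lambda>k. \<Sum>i=Suc k..Suc n. c i * ?t i k"
  have e: "(\<Sum>i=k..Suc n. c i * ?t i k) = c k * a + ?e k" if "k \<le> Suc n" for k
    using that by (simp add: sum.atLeast_Suc_atMost del: sum.cl_ivl_Suc)
  have "(\<Sum>k\<le>n. ?e k * (D ^^ k) b) = 0" for b
  proof -
    have "0 = (\<Sum>i\<le>Suc n. c i * (D ^^ i) (a * b))"
      using Suc.prems by metis
    also have "\<dots> = (\<Sum>k\<le>Suc n. (\<Sum>i=k..Suc n. c i * ?t i k) * (D ^^ k) b)"
      unfolding leibniz_funpow[OF add leibniz] sum_distrib_left sum_distrib_right sum_triangle_swap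
      by (simp only: mult.assoc)
    also have "\<dots> = (\<Sum>k\<le>Suc n. (c k * a + ?e k) * (D ^^ k) b)"
      by (intro sum.cong refl, subst e) auto
    also have "\<dots> = a * (\<Sum>k\<le>Suc n. c k * (D ^^ k) b) + (\<Sum>k\<le>Suc n. ?e k * (D ^^ k) b)"
      unfolding sum_distrib_left sum.distrib[symmetric]
      by (intro sum.cong refl) (simp only: algebra_simps)
    also have "\<dots> = (\<Sum>k\<le>Suc n. ?e k * (D ^^ k) b)"
      unfolding Suc.prems by simp
    finally show ?thesis by simp
  qed
  \<comment> \<open>The sum \<open>?e n\<close> has the single term
    \<open>c (Suc n) * of_nat (Suc n) * D a\<close>.\<close>
  then have "?e n = 0" by (rule Suc.IH)
  moreover have "(of_nat (Suc n) :: 'a) \<noteq> 0"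
    using char0 by (simp add: of_nat_eq_0_iff_char_dvd del: of_nat_Suc)
  ultimately show ?case
    using \<open>D a \<noteq> 0\<close> by (simp del: of_nat_Suc)
qed

section \<open>Consequences of preperiodicity\<close>

text \<open>Otherwise \<open>\<phi>\<close> has a Jordan block of size two,
  \<open>\<phi> b = b - c\<close> and \<open>\<phi> c = c\<close> with \<open>c \<noteq> 0\<close>.
  Then \<open>(\<phi> ^^ j) b = b - of_nat j * c\<close> never repeats in characteristic
  zero.\<close>

lemma preperiodic_locally_unipotent_eq_id:
  fixes \<phi> :: "'a::idom \<Rightarrow> 'a"
  assumes char0: "CHAR('a) = 0" and "additive \<phi>"
    and nil: "locally_nilpotent (\<lambda>x. x - \<phi> x)"
    and "k > 0" and per: "\<phi> ^^ (i + k) = \<phi> ^^ i"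
  shows "\<phi> x = x"
proof (rule ccontr)
  assume "\<phi> x \<noteq> x"
  interpret additive \<phi> by fact
  let ?\<delta> = "\<lambda>x. x - \<phi> x"
  define m where "m = (LEAST m. (?\<delta> ^^ m) x = 0)"
  have m: "(?\<delta> ^^ m) x = 0"
    unfolding m_def by (rule LeastI_ex) (use nil in \<open>auto simp: locally_nilpotent_def\<close>)
  have least: "(?\<delta> ^^ l) x \<noteq> 0" if "l < m" for l
    using that not_less_Least unfolding m_def by blast
  have "m \<noteq> 0"
    using m \<open>\<phi> x \<noteq> x\<close> zero by (metis funpow_0)
  moreover have "m \<noteq> 1"
    using m \<open>\<phi> x \<noteq> x\<close> by auto
  ultimately obtain l where l: "m = Suc (Suc l)"
    by (metis One_nat_def not0_implies_Suc)
  \<comment> \<open>\<open>b\<close> and \<open>c\<close> are the last two nonzero members of the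
    chain of iterates of \<open>?\<delta>\<close> at \<open>x\<close>.\<close>
  define b where "b = (?\<delta> ^^ l) x"
  define c where "c = ?\<delta> b"
  have "c \<noteq> 0" using least[of "Suc l"] by (simp add: l b_def c_def)
  have c: "\<phi> c = c" using m by (simp add: l b_def c_def)
  have \<phi>b: "\<phi> b = b - c" by (simp add: c_def)
  have b: "(\<phi> ^^ j) b = b - of_nat j * c" for j
  proof (induction j)
    case (Suc j)
    have "\<phi> (of_nat j * c) = of_nat j * c"
      by (induction j) (simp_all add: zero add c distrib_right)
    with Suc show ?case
      by (simp add: diff \<phi>b distrib_right)
  qed simp
  have "(\<phi> ^^ (i + k)) b = (\<phi> ^^ i) b" by (simp only: per)
  then have "of_nat k * c = 0"
    unfolding b by (simp add: algebra_simps)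
  with \<open>c \<noteq> 0\<close> \<open>k > 0\<close> char0 show False
    by (simp add: of_nat_eq_0_iff_char_dvd)
qed

text \<open>Stronger than the Mathieu condition: absorption holds from \<open>m = 1\<close> on,
  because \<open>\<phi> ^^ i\<close> already kills \<open>a\<close>.\<close>

lemma preperiodic_range_power_absorbing:
  fixes \<phi> :: "'a::idom \<Rightarrow> 'a"
  assumes char0: "CHAR('a) = 0" and "additive \<phi>"
    and mult: "\<And>x y. \<phi> (x * y) = \<phi> x * \<phi> y"
    and "k > 0" and per: "\<phi> ^^ (i + k) = \<phi> ^^ i"
    and powers: "\<And>m. m \<ge> 1 \<Longrightarrow> a ^ m \<in> range (\<lambda>x. x - \<phi> x)"
    and "m \<ge> 1"
  shows "b * a ^ m * c \<in> range (\<lambda>x. x - \<phi> x)"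
proof -
  interpret additive \<phi> by fact
  have diffs: "(\<phi> ^^ k) (x - y) = (\<phi> ^^ k) x - (\<phi> ^^ k) y" for k x y
    by (induction k) (simp_all add: diff)
  \<comment> \<open>Here \<open>x = x - (\<phi> ^^ i) x\<close>, and this difference
    telescopes.\<close>
  have kernel: "x \<in> range (\<lambda>x. x - \<phi> x)" if "(\<phi> ^^ i) x = 0" for x
  proof (rule image_eqI)
    show "x = (\<Sum>l<i. (\<phi> ^^ l) x) - \<phi> (\<Sum>l<i. (\<phi> ^^ l) x)"
      using sum_lessThan_telescope'[of "\<lambda>l. (\<phi> ^^ l) x" i] that
      by (simp add: sum sum_subtractf)
  qed simp
  note multn = funpow_mult_hom[of \<phi>, OF mult]
  \<comment> \<open>The exponent 0 is excluded since \<open>\<phi>\<close> may not fix 1.\<close>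
  have pow: "(\<phi> ^^ l) (x ^ m) = (\<phi> ^^ l) x ^ m" if "m \<ge> 1" for l x m
    using that by (induction m rule: dec_induct) (simp_all add: multn)
  have "(\<Sum>l<k. (\<phi> ^^ (i + l)) a ^ m) = 0" if m: "m \<ge> 1" for m
  proof -
    obtain y where y: "a ^ m = y - \<phi> y" using powers[OF m] by blast
    have "(\<Sum>l<k. (\<phi> ^^ (i + l)) a ^ m) = (\<Sum>l<k. (\<phi> ^^ (i + l)) y - (\<phi> ^^ (i + Suc l)) y)"
      unfolding pow[OF m, symmetric] y diffs by (simp add: funpow_swap1)
    also have "\<dots> = (\<phi> ^^ i) y - (\<phi> ^^ (i + k)) y"
      using sum_lessThan_telescope'[of "\<lambda>l. (\<phi> ^^ (i + l)) y" k] by simp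
    finally show ?thesis by (simp add: per)
  qed
  then have "(\<phi> ^^ (i + 0)) a = 0"
    using \<open>k > 0\<close>
    by (intro power_sums_zero_imp_zero[OF char0, of "{..<k}" "\<lambda>l. (\<phi> ^^ (i + l)) a" 0]) auto
  then have "(\<phi> ^^ i) (b * a ^ m * c) = 0"
    using \<open>m \<ge> 1\<close> by (simp add: multn pow)
  then show ?thesis by (rule kernel)
qed

section \<open>Transfer to the ring extension\<close>

context domain_extension
begin

lemma emb_0: "emb 0 = 0"
  using emb_add[of 0 0] by (metis add_0 add_cancel_right_right)

lemma emb_eq_0_iff: "emb x = 0 \<longleftrightarrow> x = 0"
  using inj_emb emb_0 by (metis injD)

lemma CHAR_eq_0: "CHAR('a) = 0"
proof -
  have "emb (of_nat n) = of_nat n" for n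
    by (induction n) (simp_all add: emb_0 emb_add emb_one)
  then show ?thesis
    unfolding CHAR_eq0_iff by (metis emb_eq_0_iff of_nat_eq_0_iff less_numeral_extra(3))
qed

lemma additive_module_hom: "module_hom (scal emb) (scal emb) f \<Longrightarrow> additive f"
  by (simp add: additive_def module_hom.add)

text \<open>Coefficients move from R into the larger domain, where the independence results apply;
  the leading one stays nonzero by injectivity of \<open>emb\<close>.\<close>

lemma algebraic_opE:
  assumes "algebraic_op emb \<delta>"
  obtains c n where "c n \<noteq> (0::'a)" "\<And>x. (\<Sum>i\<le>n. c i * (\<delta> ^^ i) x) = 0"
proof -
  obtain f where "f \<noteq> 0" "\<And>x. poly_op emb f \<delta> x = 0"
    using assms unfolding algebraic_op_def by blast
  then show thesis
    by (intro that[of "\<lambda>i. emb (coeff f i)" "degree f"])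
      (simp_all add: emb_eq_0_iff poly_op_def scal_def)
qed

lemma algebraic_derivation_eq_zero:
  assumes "derivation emb D" "algebraic_op emb D"
  shows "D a = 0"
  using assms derivation_powers_independent[OF CHAR_eq_0, of D a] additive_module_hom[of D]
  by (metis algebraic_opE derivation_def)

lemma algebraic_E_derivationE:
  assumes "E_derivation emb \<delta>" "algebraic_op emb \<delta>"
  obtains \<phi> k i where "\<delta> = (\<lambda>x. x - \<phi> x)" "additive \<phi>" "\<And>x y. \<phi> (x * y) = \<phi> x * \<phi> y"
    "k > 0" "\<phi> ^^ (i + k) = \<phi> ^^ i"
proof -
  obtain \<phi> where \<phi>: "module_hom (scal emb) (scal emb) \<phi>" "\<And>x y. \<phi> (x * y) = \<phi> x * \<phi> y"
      "\<delta> = (\<lambda>x. x - \<phi> x)"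
    using assms(1) unfolding E_derivation_iff by blast
  note add = additive_module_hom[OF \<phi>(1)]
  obtain c n where "c n \<noteq> (0::'a)" "\<And>x. (\<Sum>i\<le>n. c i * (\<delta> ^^ i) x) = 0"
    using algebraic_opE[OF assms(2)] by blast
  then obtain i k where "k > 0" "\<phi> ^^ (i + k) = \<phi> ^^ i"
    using preperiodic_of_algebraic_diff[OF add \<phi>(2), of c n] unfolding \<phi>(3) by blast
  with \<phi> add show thesis by (intro that[of \<phi> k i])
qed

lemma mathieu_subspace_zero: "mathieu_subspace emb {0}"
proof -
  interpret module "scal emb" by (rule module_scal)
  \<comment> \<open>Since \<open>0 ^ 0 = 1\<close>, this holds only from \<open>m = 1\<close>
    on.\<close>
  have "\<forall>\<^sub>F m in sequentially. b * 0 ^ m * c = 0" for b c :: 'a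
    using eventually_gt_at_top[of 0] by eventually_elim simp
  then show ?thesis
    unfolding mathieu_subspace_def by (auto dest: spec[of _ 1])
qed

lemma mathieu_subspace_range_E_derivation:
  assumes "E_derivation emb \<delta>" "algebraic_op emb \<delta>"
  shows "mathieu_subspace emb (range \<delta>)"
proof -
  interpret module_hom "scal emb" "scal emb" \<delta>
    using assms(1) by (simp add: E_derivation_def)
  obtain \<phi> k i where \<phi>: "\<delta> = (\<lambda>x. x - \<phi> x)" "additive \<phi>" "\<And>x y. \<phi> (x * y) = \<phi> x * \<phi> y"
    "k > 0" "\<phi> ^^ (i + k) = \<phi> ^^ i"
    by (rule algebraic_E_derivationE[OF assms]) (rule that)
  have "b * a ^ m * c \<in> range \<delta>" if "\<forall>m\<ge>1. a ^ m \<in> range \<delta>" "m \<ge> 1" for a b c m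
    using preperiodic_range_power_absorbing[OF CHAR_eq_0 \<phi>(2-5)] that unfolding \<phi>(1) by blast
  then show ?thesis
    unfolding mathieu_subspace_def eventually_sequentially
    using subspace_image[OF m1.subspace_UNIV] by blast
qed

text \<open>This reduces the claim about ideals to the zero subspace.\<close>

lemma locally_nilpotent_algebraic_eq_zero:
  assumes "derivation emb \<delta> \<or> E_derivation emb \<delta>" "locally_nilpotent \<delta>" "algebraic_op emb \<delta>"
  shows "\<delta> x = 0"
  using assms(1)
proof
  assume "derivation emb \<delta>"
  with assms(3) show ?thesis by (simp add: algebraic_derivation_eq_zero)
next
  assume "E_derivation emb \<delta>"
  then obtain \<phi> k i where \<phi>: "\<delta> = (\<lambda>x. x - \<phi> x)" "additive \<phi>"
    "\<And>x y. \<phi> (x * y) = \<phi> x * \<phi> y" "k > 0" "\<phi> ^^ (i + k) = \<phi> ^^ i"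
    by (rule algebraic_E_derivationE[OF _ assms(3)]) (rule that)
  show ?thesis
    using preperiodic_locally_unipotent_eq_id[OF CHAR_eq_0 \<phi>(2) _ \<phi>(4,5), of x] assms(2)
    unfolding \<phi>(1) by simp
qed

end

theorem theorem6p9:
  fixes emb :: "'r::{idom,ring_char_0} \<Rightarrow> 'a::idom"
  assumes "domain_extension emb"
  shows "(\<forall>\<delta>. (derivation emb \<delta> \<or> E_derivation emb \<delta>) \<and> algebraic_op emb \<delta>
            \<longrightarrow> mathieu_subspace emb (range \<delta>)) \<and>
         (\<forall>\<delta> I. (derivation emb \<delta> \<or> E_derivation emb \<delta>) \<and> locally_nilpotent \<delta> \<and>
            algebraic_op emb \<delta> \<and> is_ideal I
            \<longrightarrow> mathieu_subspace emb (\<delta> ` I))"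
proof (intro conjI allI impI; elim conjE)
  interpret domain_extension emb by fact
  fix \<delta>
  assume alg: "algebraic_op emb \<delta>" and \<delta>: "derivation emb \<delta> \<or> E_derivation emb \<delta>"
  from \<delta> show "mathieu_subspace emb (range \<delta>)"
  proof
    assume "derivation emb \<delta>"
    then have "range \<delta> = {0}"
      using algebraic_derivation_eq_zero alg by (auto simp: image_def)
    then show ?thesis by (simp add: mathieu_subspace_zero)
  qed (rule mathieu_subspace_range_E_derivation[OF _ alg])
  fix I :: "'a set"
  assume "locally_nilpotent \<delta>" "is_ideal I"
  \<comment> \<open>An ideal contains 0, so its image is \<open>{0}\<close> and not empty.\<close>
  then have "\<delta> ` I = {0}"
    using locally_nilpotent_algebraic_eq_zero[OF \<delta> _ alg] by (auto simp: is_ideal_iff image_def)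
  then show "mathieu_subspace emb (\<delta> ` I)" by (simp add: mathieu_subspace_zero)
qed

end
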